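(* The category $\mathbf{Boole}$ of Boolean algebras and Boolean homomorphisms and the category $\mathbf{kMaps}$ of compact mz-maps are isomorphic.
   Context: Boolean algebras with $0=1$ are allowed. $\mathbf{2}=\{0,1\}$ is the two-element Boolean algebra; $X_A=\mathbf{Boole}(A,\mathbf 2)$ is the set of Boolean homomorphisms $A\to\mathbf 2$. $\mathsf P(X)$ is the power set of $X$ as a complete atomic Boolean algebra. $\mathbf{Caba}$ is the category of complete atomic Boolean algebras and complete Boolean homomorphisms; $\mathrm{At}(B)$ is the set of atoms of $B$. $\mathrm{CO}(X)$ is the set of clopen subsets of a space $X$. For a Boolean algebra $A$ and $a\in A$, put $s_A(a)=\{x\in X_A\mid x(a)=1\}$; the Stone space $\mathsf S(A)$ is $X_A$ with the topology having $\{s_A(a)\mid a\in A\}$ as a base. For $X\subseteq X_A$, $s_A^X:A\to\mathsf P(X)$ is $s_A^X(a)=X\cap s_A(a)$. For a Boolean homomorphism $\alpha:A\to B$ and $x\in\mathrm{At}(B)$, let $\alpha_x:A\to\mathbf 2$ be given by $\alpha_x(a)=1\Leftrightarrow x\le\alpha(a)$; put $X_\alpha=\{\alpha_x\mid x\in\mathrm{At}(B)\}$. For a Boolean algebra $A$ and $B\in\mathbf{Caba}$, a Boolean monomorphism $\alpha:A\to B$ is a Boolean z-map if every atom of $B$ is a meet of some elements of $\alpha(A)$; it is an mz-map (maximal Boolean z-map) if moreover $\mathrm{CO}(X_\alpha)=s_A^{X_\alpha}(A)$, where $X_\alpha$ is a subspace of $\mathsf S(A)$. $\mathbf{mzMaps}$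 is the category whose objects are all mz-maps and whose morphisms from $\alpha:A\to B$ to $\alpha':A'\to B'$ are all pairs $(\varphi,\sigma)$ with $\varphi:A\to A'$ a Boolean homomorphism, $\sigma:B\to B'$ a complete Boolean homomorphism and $\alpha'\circ\varphi=\sigma\circ\alpha$; composition is componentwise and identities are $(id_A,id_B)$. A compact mz-map is a map of the form $s_A^{X_A}:A\to\mathsf P(X_A)$ with $A$ a Boolean algebra (such a map is an mz-map). $\mathbf{kMaps}$ is the full subcategory of $\mathbf{mzMaps}$ whose objects are all compact mz-maps. *)

theory Defs
  imports "HOL-Analysis.Abstract_Topology" "HOL-Algebra.Complete_Lattice" "HOL-Library.FuncSet"
begin

section \<open>Categories, functors, isomorphism of categories\<close>

text \<open>
  Hom-sets need not be disjoint, so composition and the action of a functor on morphisms take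
  the objects involved as parameters: \<open>Cmp C a b c g f\<close> is the composite of
  \<open>f \<in> Hom C a b\<close> and \<open>g \<in> Hom C b c\<close>, and \<open>Fm a b f\<close> is the image of \<open>f \<in> Hom C a b\<close>.
\<close>

record ('o, 'm) cat =
  Obj :: "'o set"
  Hom :: "'o \<Rightarrow> 'o \<Rightarrow> 'm set"
  Idt :: "'o \<Rightarrow> 'm"
  Cmp :: "'o \<Rightarrow> 'o \<Rightarrow> 'o \<Rightarrow> 'm \<Rightarrow> 'm \<Rightarrow> 'm"

locale category =
  fixes C :: "('o, 'm) cat"
  assumes Idt_in_Hom: "a \<in> Obj C \<Longrightarrow> Idt C a \<in> Hom C a a"
    and Cmp_in_Hom: "\<lbrakk>a \<in> Obj C; b \<in> Obj C; c \<in> Obj C; f \<in> Hom C a b; g \<in> Hom C b c\<rbrakk>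
      \<Longrightarrow> Cmp C a b c g f \<in> Hom C a c"
    and Cmp_Idt_right: "\<lbrakk>a \<in> Obj C; b \<in> Obj C; f \<in> Hom C a b\<rbrakk> \<Longrightarrow> Cmp C a a b f (Idt C a) = f"
    and Cmp_Idt_left: "\<lbrakk>a \<in> Obj C; b \<in> Obj C; f \<in> Hom C a b\<rbrakk> \<Longrightarrow> Cmp C a b b (Idt C b) f = f"
    and Cmp_assoc: "\<lbrakk>a \<in> Obj C; b \<in> Obj C; c \<in> Obj C; d \<in> Obj C;
        f \<in> Hom C a b; g \<in> Hom C b c; h \<in> Hom C c d\<rbrakk>
      \<Longrightarrow> Cmp C a c d h (Cmp C a b c g f) = Cmp C a b d (Cmp C b c d h g) f"

locale cat_functor = dom: category C + cod: category D
  for C :: "('o, 'm) cat" and D :: "('p, 'n) cat" +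
  fixes Fo :: "'o \<Rightarrow> 'p" and Fm :: "'o \<Rightarrow> 'o \<Rightarrow> 'm \<Rightarrow> 'n"
  assumes Fo_Obj: "a \<in> Obj C \<Longrightarrow> Fo a \<in> Obj D"
    and Fm_Hom: "\<lbrakk>a \<in> Obj C; b \<in> Obj C; f \<in> Hom C a b\<rbrakk> \<Longrightarrow> Fm a b f \<in> Hom D (Fo a) (Fo b)"
    and Fm_Idt: "a \<in> Obj C \<Longrightarrow> Fm a a (Idt C a) = Idt D (Fo a)"
    and Fm_Cmp: "\<lbrakk>a \<in> Obj C; b \<in> Obj C; c \<in> Obj C; f \<in> Hom C a b; g \<in> Hom C b c\<rbrakk>
      \<Longrightarrow> Fm a c (Cmp C a b c g f) = Cmp D (Fo a) (Fo b) (Fo c) (Fm b c g) (Fm a b f)"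

text \<open>Isomorphism (not just equivalence): functors whose two composites equal the identity functors.\<close>

definition isomorphic_cats :: "('o, 'm) cat \<Rightarrow> ('p, 'n) cat \<Rightarrow> bool" where
  "isomorphic_cats C D \<longleftrightarrow> (\<exists>Fo Fm Go Gm.
     cat_functor C D Fo Fm \<and> cat_functor D C Go Gm \<and>
     (\<forall>a\<in>Obj C. Go (Fo a) = a) \<and>
     (\<forall>a\<in>Obj C. \<forall>b\<in>Obj C. \<forall>f\<in>Hom C a b. Gm (Fo a) (Fo b) (Fm a b f) = f) \<and>
     (\<forall>x\<in>Obj D. Fo (Go x) = x) \<and>
     (\<forall>x\<in>Obj D. \<forall>y\<in>Obj D. \<forall>g\<in>Hom D x y. Fm (Go x) (Go y) (Gm x y g) = g))"

definition full_subcat :: "('o, 'm) cat \<Rightarrow> ('o \<Rightarrow> bool) \<Rightarrow> ('o, 'm) cat" where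
  "full_subcat C P = C\<lparr>Obj := {a \<in> Obj C. P a}\<rparr>"


section \<open>Boolean algebras\<close>

text \<open>
  The axiom \<open>le_carrier\<close> is a normalisation: the values of \<open>le\<close> outside the
  carrier carry no information, and fixing them makes equality of records coincide with equality
  of Boolean algebras.  Bottom and top may coincide.
\<close>

locale boolean_alg = bounded_lattice L for L :: "'a gorder" (structure) +
  assumes le_carrier: "x \<sqsubseteq> y \<Longrightarrow> x \<in> carrier L \<and> y \<in> carrier L"
    and distrib: "\<lbrakk>x \<in> carrier L; y \<in> carrier L; z \<in> carrier L\<rbrakk>
      \<Longrightarrow> x \<sqinter> (y \<squnion> z) = (x \<sqinter> y) \<squnion> (x \<sqinter> z)"
    and complemented: "x \<in> carrier L \<Longrightarrow> \<exists>y\<in>carrier L. x \<squnion> y = \<top> \<and> x \<sqinter> y = \<bottom>"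

definition bcompl :: "'a gorder \<Rightarrow> 'a \<Rightarrow> 'a" where
  "bcompl L x = (THE y. y \<in> carrier L \<and> x \<squnion>\<^bsub>L\<^esub> y = \<top>\<^bsub>L\<^esub> \<and> x \<sqinter>\<^bsub>L\<^esub> y = \<bottom>\<^bsub>L\<^esub>)"

definition atoms :: "'a gorder \<Rightarrow> 'a set" where
  "atoms L = {x \<in> carrier L. x \<noteq> \<bottom>\<^bsub>L\<^esub> \<and> (\<forall>y\<in>carrier L. y \<sqsubseteq>\<^bsub>L\<^esub> x \<longrightarrow> y = \<bottom>\<^bsub>L\<^esub> \<or> y = x)}"

definition caba :: "'a gorder \<Rightarrow> bool" where
  "caba L \<longleftrightarrow> boolean_alg L \<and> complete_lattice L \<and>
     (\<forall>y\<in>carrier L. y \<noteq> \<bottom>\<^bsub>L\<^esub> \<longrightarrow> (\<exists>x\<in>atoms L. x \<sqsubseteq>\<^bsub>L\<^esub> y))"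

text \<open>Maps are extensional: they are \<open>undefined\<close> outside the carrier of their domain.\<close>

definition bool_hom :: "'a gorder \<Rightarrow> 'b gorder \<Rightarrow> ('a \<Rightarrow> 'b) set" where
  "bool_hom A B = {f \<in> carrier A \<rightarrow>\<^sub>E carrier B.
     join_pres A B f \<and> meet_pres A B f \<and>
     f \<bottom>\<^bsub>A\<^esub> = \<bottom>\<^bsub>B\<^esub> \<and> f \<top>\<^bsub>A\<^esub> = \<top>\<^bsub>B\<^esub> \<and>
     (\<forall>x\<in>carrier A. f (bcompl A x) = bcompl B (f x))}"

definition complete_bool_hom :: "'a gorder \<Rightarrow> 'b gorder \<Rightarrow> ('a \<Rightarrow> 'b) set" where
  "complete_bool_hom A B = {f \<in> bool_hom A B. sup_pres A B f \<and> inf_pres A B f}"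

definition Boole :: "('a gorder, 'a \<Rightarrow> 'a) cat" where
  "Boole = \<lparr>Obj = {A. boolean_alg A}, Hom = bool_hom,
     Idt = (\<lambda>A. restrict id (carrier A)),
     Cmp = (\<lambda>A B C g f. compose (carrier A) g f)\<rparr>"


section \<open>Stone spaces\<close>

definition two_alg :: "bool gorder" where
  "two_alg = \<lparr>carrier = UNIV, eq = (=), le = (\<le>)\<rparr>"

definition pow_alg :: "'a set \<Rightarrow> 'a set gorder" where
  "pow_alg X = \<lparr>carrier = Pow X, eq = (=), le = (\<lambda>U V. U \<subseteq> V \<and> V \<subseteq> X)\<rparr>"

definition stone_pts :: "'a gorder \<Rightarrow> ('a \<Rightarrow> bool) set" where
  "stone_pts A = bool_hom A two_alg"

definition stone_set :: "'a gorder \<Rightarrow> 'a \<Rightarrow> ('a \<Rightarrow> bool) set" where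
  "stone_set A a = {x \<in> stone_pts A. x a}"

definition stone_space :: "'a gorder \<Rightarrow> ('a \<Rightarrow> bool) topology" where
  "stone_space A = topology (arbitrary union_of (\<lambda>U. U \<in> stone_set A ` carrier A))"

definition stone_map :: "'a gorder \<Rightarrow> ('a \<Rightarrow> bool) set \<Rightarrow> 'a \<Rightarrow> ('a \<Rightarrow> bool) set" where
  "stone_map A X = (\<lambda>a\<in>carrier A. X \<inter> stone_set A a)"

definition clopens :: "'a topology \<Rightarrow> 'a set set" where
  "clopens T = {U. openin T U \<and> closedin T U}"


section \<open>Maximal Boolean z-maps\<close>

definition atom_pt :: "'a gorder \<Rightarrow> 'b gorder \<Rightarrow> ('a \<Rightarrow> 'b) \<Rightarrow> 'b \<Rightarrow> ('a \<Rightarrow> bool)" where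
  "atom_pt A B \<alpha> x = (\<lambda>a\<in>carrier A. x \<sqsubseteq>\<^bsub>B\<^esub> \<alpha> a)"

definition atom_pts :: "'a gorder \<Rightarrow> 'b gorder \<Rightarrow> ('a \<Rightarrow> 'b) \<Rightarrow> ('a \<Rightarrow> bool) set" where
  "atom_pts A B \<alpha> = atom_pt A B \<alpha> ` atoms B"

definition z_map :: "'a gorder \<Rightarrow> 'b gorder \<Rightarrow> ('a \<Rightarrow> 'b) \<Rightarrow> bool" where
  "z_map A B \<alpha> \<longleftrightarrow> boolean_alg A \<and> caba B \<and> \<alpha> \<in> bool_hom A B \<and> inj_on \<alpha> (carrier A) \<and>
     (\<forall>x\<in>atoms B. \<exists>S \<subseteq> \<alpha> ` carrier A. x = \<Sqinter>\<^bsub>B\<^esub> S)"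

definition mz_map :: "'a gorder \<Rightarrow> 'b gorder \<Rightarrow> ('a \<Rightarrow> 'b) \<Rightarrow> bool" where
  "mz_map A B \<alpha> \<longleftrightarrow> z_map A B \<alpha> \<and>
     clopens (subtopology (stone_space A) (atom_pts A B \<alpha>)) =
     stone_map A (atom_pts A B \<alpha>) ` carrier A"

text \<open>A map is an object, so it comes with its domain and codomain.\<close>

record ('a, 'b) alg_map =
  Dom :: "'a gorder"
  Cod :: "'b gorder"
  Fun :: "'a \<Rightarrow> 'b"

definition mzMaps :: "(('a, 'b) alg_map, ('a \<Rightarrow> 'a) \<times> ('b \<Rightarrow> 'b)) cat" where
  "mzMaps = \<lparr>Obj = {m. mz_map (Dom m) (Cod m) (Fun m)},
     Hom = (\<lambda>m n. {(\<phi>, \<sigma>). \<phi> \<in> bool_hom (Dom m) (Dom n) \<and>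
        \<sigma> \<in> complete_bool_hom (Cod m) (Cod n) \<and>
        compose (carrier (Dom m)) (Fun n) \<phi> = compose (carrier (Dom m)) \<sigma> (Fun m)}),
     Idt = (\<lambda>m. (restrict id (carrier (Dom m)), restrict id (carrier (Cod m)))),
     Cmp = (\<lambda>m n k (\<psi>, \<tau>) (\<phi>, \<sigma>).
        (compose (carrier (Dom m)) \<psi> \<phi>, compose (carrier (Cod m)) \<tau> \<sigma>))\<rparr>"

definition compact_map :: "'a gorder \<Rightarrow> ('a, ('a \<Rightarrow> bool) set) alg_map" where
  "compact_map A = \<lparr>Dom = A, Cod = pow_alg (stone_pts A), Fun = stone_map A (stone_pts A)\<rparr>"

definition kMaps ::
  "(('a, ('a \<Rightarrow> bool) set) alg_map, ('a \<Rightarrow> 'a) \<times> (('a \<Rightarrow> bool) set \<Rightarrow> ('a \<Rightarrow> bool) set)) cat" where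
  "kMaps = full_subcat mzMaps (\<lambda>m. \<exists>A. boolean_alg A \<and> m = compact_map A)"

end

theory Submission
  imports Defs
begin

text \<open>The ultrafilter theorem and compactness of the Stone space make every \<open>s\<^sub>A\<close> with values in
  \<open>P(X\<^sub>A)\<close> an mz-map.  A Boolean homomorphism \<open>\<phi> : A \<rightarrow> B\<close> induces a complete homomorphism
  \<open>P(X\<^sub>A) \<rightarrow> P(X\<^sub>B)\<close>, the preimage under \<open>y \<mapsto> y \<circ> \<phi>\<close>.  It is the only complete homomorphism
  compatible with \<open>\<phi>\<close>, because every point of \<open>X\<^sub>A\<close> is the intersection of the basic clopen sets
  containing it and every subset of \<open>X\<^sub>A\<close> is a union of points.  So morphisms of compact
  mz-maps correspond bijectively to Boolean homomorphisms.\<close>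

section \<open>Boolean algebras\<close>

context boolean_alg
begin

text \<open>By distributivity \<open>y\<close> is the join of \<open>y \<sqinter> x\<close>, which
  vanishes, and \<open>y \<sqinter> z\<close>. The inequality yields both the uniqueness of
  complements and the separation of elements by points.\<close>

lemma complement_le:
  assumes "x \<in> carrier L" "y \<in> carrier L" "z \<in> carrier L"
    and "x \<sqinter> y = \<bottom>" "x \<squnion> z = \<top>"
  shows "y \<sqsubseteq> z"
proof -
  have "y = y \<sqinter> (x \<squnion> z)"
    using assms top_meet[of y] by (simp add: eq_is_equal meet_comm)
  also have "\<dots> = (y \<sqinter> x) \<squnion> (y \<sqinter> z)"
    using assms(1-3) by (simp add: distrib)
  also have "\<dots> = y \<sqinter> z"
    using assms bottom_join[of "y \<sqinter> z"] by (simp add: eq_is_equal meet_comm[of L y x])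
  finally show ?thesis
    using assms meet_right by metis
qed

text \<open>Two complements of \<open>x\<close> lie below each other by
  \<open>complement_le\<close>, so the definite description in \<open>bcompl\<close> denotes
  whichever complement is at hand.\<close>

lemma bcompl_eqI:
  assumes "x \<in> carrier L" "y \<in> carrier L" "x \<squnion> y = \<top>" "x \<sqinter> y = \<bottom>"
  shows "bcompl L x = y"
  unfolding bcompl_def
  by (rule the_equality) (use assms complement_le in \<open>auto intro!: le_antisym\<close>)

lemma
  assumes "x \<in> carrier L"
  shows bcompl_closed [simp]: "bcompl L x \<in> carrier L"
    and join_bcompl [simp]: "x \<squnion> bcompl L x = \<top>"
    and meet_bcompl [simp]: "x \<sqinter> bcompl L x = \<bottom>"
  using complemented[OF assms] bcompl_eqI[OF assms] by auto

lemma le_top_iff: "x \<in> carrier L \<Longrightarrow> \<top> \<sqsubseteq> x \<longleftrightarrow> x = \<top>"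
  by (auto intro: le_antisym)

end

text \<open>The complement clause of \<open>bool_hom\<close> comes from uniqueness of complements:
  the images of \<open>x\<close> and of its complement join to top and meet in bottom.\<close>

lemma bool_homI:
  assumes A: "boolean_alg A" and B: "boolean_alg B"
    and f: "f \<in> carrier A \<rightarrow>\<^sub>E carrier B"
    and join: "\<And>x y. \<lbrakk>x \<in> carrier A; y \<in> carrier A\<rbrakk> \<Longrightarrow> f (x \<squnion>\<^bsub>A\<^esub> y) = f x \<squnion>\<^bsub>B\<^esub> f y"
    and meet: "\<And>x y. \<lbrakk>x \<in> carrier A; y \<in> carrier A\<rbrakk> \<Longrightarrow> f (x \<sqinter>\<^bsub>A\<^esub> y) = f x \<sqinter>\<^bsub>B\<^esub> f y"
    and bot: "f \<bottom>\<^bsub>A\<^esub> = \<bottom>\<^bsub>B\<^esub>" and top: "f \<top>\<^bsub>A\<^esub> = \<top>\<^bsub>B\<^esub>"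
  shows "f \<in> bool_hom A B"
proof -
  interpret A: boolean_alg A by fact
  interpret B: boolean_alg B by fact
  have "f (bcompl A x) = bcompl B (f x)" if x: "x \<in> carrier A" for x
  proof (rule B.bcompl_eqI[symmetric])
    show "f x \<squnion>\<^bsub>B\<^esub> f (bcompl A x) = \<top>\<^bsub>B\<^esub>" "f x \<sqinter>\<^bsub>B\<^esub> f (bcompl A x) = \<bottom>\<^bsub>B\<^esub>"
      using x by (simp_all flip: join meet add: bot top)
  qed (use f x in auto)
  then show ?thesis
    using assms A.lattice_axioms B.lattice_axioms
    by (auto simp: bool_hom_def join_pres_def meet_pres_def)
qed

lemma bool_homD:
  assumes "f \<in> bool_hom A B"
  shows "f \<in> carrier A \<rightarrow>\<^sub>E carrier B"
    and "\<And>x y. \<lbrakk>x \<in> carrier A; y \<in> carrier A\<rbrakk> \<Longrightarrow> f (x \<squnion>\<^bsub>A\<^esub> y) = f x \<squnion>\<^bsub>B\<^esub> f y"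
    and "\<And>x y. \<lbrakk>x \<in> carrier A; y \<in> carrier A\<rbrakk> \<Longrightarrow> f (x \<sqinter>\<^bsub>A\<^esub> y) = f x \<sqinter>\<^bsub>B\<^esub> f y"
    and "f \<bottom>\<^bsub>A\<^esub> = \<bottom>\<^bsub>B\<^esub>" and "f \<top>\<^bsub>A\<^esub> = \<top>\<^bsub>B\<^esub>"
    and "\<And>x. x \<in> carrier A \<Longrightarrow> f (bcompl A x) = bcompl B (f x)"
  using assms by (auto simp: bool_hom_def join_pres_def meet_pres_def)

lemma bool_hom_closed: "f \<in> bool_hom A B \<Longrightarrow> x \<in> carrier A \<Longrightarrow> f x \<in> carrier B"
  using bool_homD(1) by blast

lemma restrict_id_bool_hom:
  assumes "boolean_alg A"
  shows "restrict id (carrier A) \<in> bool_hom A A"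
proof -
  interpret boolean_alg A by fact
  show ?thesis
    by (rule bool_homI) (auto simp: assms)
qed

lemma compose_bool_hom:
  assumes "boolean_alg A" "boolean_alg C" and f: "f \<in> bool_hom A B" and g: "g \<in> bool_hom B C"
  shows "compose (carrier A) g f \<in> bool_hom A C"
proof -
  interpret boolean_alg A by fact
  show ?thesis
    by (rule bool_homI)
      (use assms bool_hom_closed[OF f] bool_hom_closed[OF g] in
        \<open>auto simp: compose_def bool_homD[OF f] bool_homD[OF g]\<close>)
qed

section \<open>Complete Boolean homomorphisms, their identities and composites\<close>

lemma complete_bool_homD:
  assumes "f \<in> complete_bool_hom A B"
  shows "f \<in> bool_hom A B" "complete_lattice A" "complete_lattice B"
    and "S \<subseteq> carrier A \<Longrightarrow> f (\<Squnion>\<^bsub>A\<^esub>S) = \<Squnion>\<^bsub>B\<^esub>(f ` S)"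
    and "S \<subseteq> carrier A \<Longrightarrow> f (\<Sqinter>\<^bsub>A\<^esub>S) = \<Sqinter>\<^bsub>B\<^esub>(f ` S)"
  using assms by (auto simp: complete_bool_hom_def sup_pres_def inf_pres_def)

lemma complete_bool_homI:
  assumes "f \<in> bool_hom A B" "complete_lattice A" "complete_lattice B"
    and "\<And>S. S \<subseteq> carrier A \<Longrightarrow> f (\<Squnion>\<^bsub>A\<^esub>S) = \<Squnion>\<^bsub>B\<^esub>(f ` S)"
    and "\<And>S. S \<subseteq> carrier A \<Longrightarrow> f (\<Sqinter>\<^bsub>A\<^esub>S) = \<Sqinter>\<^bsub>B\<^esub>(f ` S)"
  shows "f \<in> complete_bool_hom A B"
  using assms by (auto simp: complete_bool_hom_def sup_pres_def inf_pres_def)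

lemma cabaD:
  assumes "caba B"
  shows "boolean_alg B" "complete_lattice B"
  using assms by (auto simp: caba_def)

lemma restrict_id_complete_bool_hom:
  assumes "caba B"
  shows "restrict id (carrier B) \<in> complete_bool_hom B B"
proof -
  interpret complete_lattice B
    using assms by (rule cabaD)
  have *: "restrict id (carrier B) ` S = S" if "S \<subseteq> carrier B" for S
    using that by (force simp: image_iff)
  show ?thesis
    by (rule complete_bool_homI)
      (use restrict_id_bool_hom[of B] assms * in \<open>auto simp: cabaD\<close>)
qed

lemma compose_complete_bool_hom:
  assumes "caba A" "caba C"
    and f: "f \<in> complete_bool_hom A B" and g: "g \<in> complete_bool_hom B C"
  shows "compose (carrier A) g f \<in> complete_bool_hom A C"
proof -
  \<comment> \<open>Completeness of \<open>A\<close> puts joins and meets of \<open>S\<close> into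
    the carrier, where \<open>compose\<close> is genuine composition rather than
    \<open>undefined\<close>.\<close>
  interpret complete_lattice A
    using assms(1) by (rule cabaD)
  have im: "compose (carrier A) g f ` S = g ` f ` S" if "S \<subseteq> carrier A" for S
    using that by (force simp: compose_def image_iff)
  have fS: "f ` S \<subseteq> carrier B" if "S \<subseteq> carrier A" for S
    using that bool_hom_closed[OF complete_bool_homD(1)[OF f]] by auto
  show ?thesis
  proof (rule complete_bool_homI)
    show "compose (carrier A) g f \<in> bool_hom A C"
      using assms by (intro compose_bool_hom) (auto dest: cabaD complete_bool_homD)
  next
    fix S assume S: "S \<subseteq> carrier A"
    show "compose (carrier A) g f (\<Squnion>\<^bsub>A\<^esub>S) = \<Squnion>\<^bsub>C\<^esub>(compose (carrier A) g f ` S)"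
      using S fS by (simp add: im compose_eq complete_bool_homD(4)[OF f] complete_bool_homD(4)[OF g])
    show "compose (carrier A) g f (\<Sqinter>\<^bsub>A\<^esub>S) = \<Sqinter>\<^bsub>C\<^esub>(compose (carrier A) g f ` S)"
      using S fS by (simp add: im compose_eq complete_bool_homD(5)[OF f] complete_bool_homD(5)[OF g])
  qed (use assms cabaD in auto)
qed


section \<open>Power sets and the two-element algebra\<close>

text \<open>The supremum is chosen among least upper bounds, and antisymmetry leaves only one
  candidate.\<close>

lemma (in partial_order) sup_eqI: "is_lub L s S \<Longrightarrow> \<Squnion>S = s"
  unfolding Lattice.sup_def by (metis least_unique someI_ex)

lemma (in partial_order) inf_eqI: "is_glb L s S \<Longrightarrow> \<Sqinter>S = s"
  unfolding Lattice.inf_def by (metis greatest_unique someI_ex)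

lemma carrier_pow_alg [simp]: "carrier (pow_alg X) = Pow X"
  by (simp add: pow_alg_def)

lemma le_pow_alg [simp]: "U \<sqsubseteq>\<^bsub>pow_alg X\<^esub> V \<longleftrightarrow> U \<subseteq> V \<and> V \<subseteq> X"
  by (simp add: pow_alg_def)

lemma partial_order_pow_alg: "partial_order (pow_alg X)"
  by unfold_locales (auto simp: pow_alg_def)

lemma is_lub_pow_alg: "S \<subseteq> Pow X \<Longrightarrow> is_lub (pow_alg X) (\<Union>S) S"
  by (rule least_UpperI) (fastforce simp: Upper_def)+

text \<open>Intersecting with \<open>X\<close> matters for empty \<open>S\<close>, whose meet is
  \<open>X\<close> while \<open>\<Inter>S\<close> is the whole type.\<close>

lemma is_glb_pow_alg: "S \<subseteq> Pow X \<Longrightarrow> is_glb (pow_alg X) (X \<inter> \<Inter>S) S"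
  by (rule greatest_LowerI) (fastforce simp: Lower_def)+

lemma complete_lattice_pow_alg: "complete_lattice (pow_alg X)"
  by (rule partial_order.complete_latticeI[OF partial_order_pow_alg])
    (metis is_lub_pow_alg carrier_pow_alg, metis is_glb_pow_alg carrier_pow_alg)

lemma
  assumes "S \<subseteq> Pow X"
  shows sup_pow_alg: "\<Squnion>\<^bsub>pow_alg X\<^esub>S = \<Union>S"
    and inf_pow_alg: "\<Sqinter>\<^bsub>pow_alg X\<^esub>S = X \<inter> \<Inter>S"
  using partial_order.sup_eqI[OF partial_order_pow_alg is_lub_pow_alg[OF assms]]
    partial_order.inf_eqI[OF partial_order_pow_alg is_glb_pow_alg[OF assms]]
  by blast+

lemma
  assumes "U \<subseteq> X" "V \<subseteq> X"
  shows join_pow_alg: "U \<squnion>\<^bsub>pow_alg X\<^esub> V = U \<union> V"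
    and meet_pow_alg: "U \<sqinter>\<^bsub>pow_alg X\<^esub> V = U \<inter> V"
  using assms by (auto simp: join_def meet_def sup_pow_alg inf_pow_alg)

lemma bounded_lattice_pow_alg: "bounded_lattice (pow_alg X)"
proof -
  interpret complete_lattice "pow_alg X"
    by (rule complete_lattice_pow_alg)
  show ?thesis ..
qed

lemma bottom_pow_alg [simp]: "\<bottom>\<^bsub>pow_alg X\<^esub> = {}"
  by (rule bounded_lattice.bottom_eq[OF bounded_lattice_pow_alg, symmetric]) auto

lemma top_pow_alg [simp]: "\<top>\<^bsub>pow_alg X\<^esub> = X"
  by (rule bounded_lattice.top_eq[OF bounded_lattice_pow_alg, symmetric]) auto

lemma boolean_alg_pow_alg: "boolean_alg (pow_alg X)"
proof -
  interpret bounded_lattice "pow_alg X"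
    by (rule bounded_lattice_pow_alg)
  show ?thesis
  proof
    fix U V W assume "U \<in> carrier (pow_alg X)" "V \<in> carrier (pow_alg X)" "W \<in> carrier (pow_alg X)"
    then have "U \<subseteq> X" "V \<subseteq> X" "W \<subseteq> X" "V \<union> W \<subseteq> X" "U \<inter> V \<subseteq> X" "U \<inter> W \<subseteq> X"
      by auto
    then show "U \<sqinter>\<^bsub>pow_alg X\<^esub> (V \<squnion>\<^bsub>pow_alg X\<^esub> W) = U \<sqinter>\<^bsub>pow_alg X\<^esub> V \<squnion>\<^bsub>pow_alg X\<^esub> (U \<sqinter>\<^bsub>pow_alg X\<^esub> W)"
      by (simp add: join_pow_alg meet_pow_alg Int_Un_distrib)
  next
    fix U assume "U \<in> carrier (pow_alg X)"
    then show "\<exists>V\<in>carrier (pow_alg X). U \<squnion>\<^bsub>pow_alg X\<^esub> V = \<top>\<^bsub>pow_alg X\<^esub> \<and> U \<sqinter>\<^bsub>pow_alg X\<^esub> V = \<bottom>\<^bsub>pow_alg X\<^esub>"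
      by (intro bexI[of _ "X - U"]) (auto simp: join_pow_alg meet_pow_alg)
  qed auto
qed

lemma atoms_pow_alg: "atoms (pow_alg X) = (\<lambda>x. {x}) ` X"
proof (intro equalityI subsetI)
  fix U assume U: "U \<in> atoms (pow_alg X)"
  then obtain x where "x \<in> U" "U \<subseteq> X"
    by (auto simp: atoms_def)
  with U have "{x} = U"
    by (auto simp: atoms_def dest!: bspec[of _ _ "{x}"])
  with \<open>x \<in> U\<close> \<open>U \<subseteq> X\<close> show "U \<in> (\<lambda>x. {x}) ` X"
    by blast
qed (auto simp: atoms_def)

lemma caba_pow_alg: "caba (pow_alg X)"
  unfolding caba_def
  by (auto simp: boolean_alg_pow_alg complete_lattice_pow_alg atoms_pow_alg)

text \<open>Preimages commute with all unions and intersections. That \<open>g\<close> maps into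
  \<open>X\<close> sends top to top and makes the meet of the empty family come out right.\<close>

lemma preimage_complete_bool_hom:
  assumes g: "g \<in> Y \<rightarrow> X"
  shows "(\<lambda>U\<in>Pow X. {y \<in> Y. g y \<in> U}) \<in> complete_bool_hom (pow_alg X) (pow_alg Y)"
    (is "?h \<in> _")
proof (rule complete_bool_homI)
  show "?h \<in> bool_hom (pow_alg X) (pow_alg Y)"
  proof (rule bool_homI)
    fix U V assume "U \<in> carrier (pow_alg X)" "V \<in> carrier (pow_alg X)"
    then have "U \<subseteq> X" "V \<subseteq> X" "U \<union> V \<subseteq> X" "U \<inter> V \<subseteq> X"
      "{y \<in> Y. g y \<in> U} \<subseteq> Y" "{y \<in> Y. g y \<in> V} \<subseteq> Y"
      by auto
    then show "?h (U \<squnion>\<^bsub>pow_alg X\<^esub> V) = ?h U \<squnion>\<^bsub>pow_alg Y\<^esub> ?h V"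
      and "?h (U \<sqinter>\<^bsub>pow_alg X\<^esub> V) = ?h U \<sqinter>\<^bsub>pow_alg Y\<^esub> ?h V"
      by (auto simp: join_pow_alg meet_pow_alg)
  qed (use g in \<open>auto simp: boolean_alg_pow_alg\<close>)
next
  fix S assume "S \<subseteq> carrier (pow_alg X)"
  then have S: "S \<subseteq> Pow X" "\<Union>S \<subseteq> X" "X \<inter> \<Inter>S \<subseteq> X" "?h ` S \<subseteq> Pow Y"
    by auto
  have im: "?h ` S = (\<lambda>U. {y \<in> Y. g y \<in> U}) ` S"
    by (rule image_cong) (use \<open>S \<subseteq> Pow X\<close> in auto)
  show "?h (\<Squnion>\<^bsub>pow_alg X\<^esub>S) = \<Squnion>\<^bsub>pow_alg Y\<^esub>(?h ` S)"
    using S by (simp only: sup_pow_alg) (auto simp: im)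
  show "?h (\<Sqinter>\<^bsub>pow_alg X\<^esub>S) = \<Sqinter>\<^bsub>pow_alg Y\<^esub>(?h ` S)"
    using S g by (simp only: inf_pow_alg im) auto
qed (rule complete_lattice_pow_alg)+

section \<open>The two-element algebra as a target of homomorphisms\<close>

lemma carrier_two_alg [simp]: "carrier two_alg = UNIV"
  by (simp add: two_alg_def)

lemma le_two_alg [simp]: "p \<sqsubseteq>\<^bsub>two_alg\<^esub> q \<longleftrightarrow> (p \<longrightarrow> q)"
  by (simp add: two_alg_def)

lemma partial_order_two_alg: "partial_order two_alg"
  by unfold_locales (auto simp: two_alg_def)

lemma is_lub_two_alg: "is_lub two_alg (p \<or> q) {p, q}"
  by (rule least_UpperI) (auto simp: Upper_def)

lemma is_glb_two_alg: "is_glb two_alg (p \<and> q) {p, q}"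
  by (rule greatest_LowerI) (auto simp: Lower_def)

lemma join_two_alg [simp]: "p \<squnion>\<^bsub>two_alg\<^esub> q \<longleftrightarrow> p \<or> q"
  unfolding join_def by (rule partial_order.sup_eqI[OF partial_order_two_alg is_lub_two_alg])

lemma meet_two_alg [simp]: "p \<sqinter>\<^bsub>two_alg\<^esub> q \<longleftrightarrow> p \<and> q"
  unfolding meet_def by (rule partial_order.inf_eqI[OF partial_order_two_alg is_glb_two_alg])

lemma bounded_lattice_two_alg: "bounded_lattice two_alg"
proof -
  interpret partial_order two_alg
    by (rule partial_order_two_alg)
  show ?thesis
    by unfold_locales
      (use is_lub_two_alg is_glb_two_alg in blast, use is_lub_two_alg is_glb_two_alg in blast,
        auto simp: least_def greatest_def)
qed

lemma bottom_two_alg [simp]: "\<bottom>\<^bsub>two_alg\<^esub> = False"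
  by (rule bounded_lattice.bottom_eq[OF bounded_lattice_two_alg, symmetric]) auto

lemma top_two_alg [simp]: "\<top>\<^bsub>two_alg\<^esub> = True"
  by (rule bounded_lattice.top_eq[OF bounded_lattice_two_alg, symmetric]) auto

lemma boolean_alg_two_alg: "boolean_alg two_alg"
proof -
  interpret bounded_lattice two_alg
    by (rule bounded_lattice_two_alg)
  show ?thesis
    by unfold_locales auto
qed


section \<open>Stone duality\<close>

text \<open>Zorn's lemma is applied to sets with this property instead of proper ideals, so that no
  closure under joins has to be maintained; maximal such sets are prime ideals.\<close>

definition no_finite_cover :: "'a gorder \<Rightarrow> 'a set \<Rightarrow> bool" where
  "no_finite_cover L M \<longleftrightarrow> M \<subseteq> carrier L \<and>
     (\<forall>F\<subseteq>M. finite F \<longrightarrow> (\<exists>u\<in>carrier L. u \<noteq> \<top>\<^bsub>L\<^esub> \<and> (\<forall>a\<in>F. a \<sqsubseteq>\<^bsub>L\<^esub> u)))"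

text \<open>The property has finite character: a finite subset of the union of a chain lies in one
  member of the chain. Hence Zorn's lemma applies, with \<open>S\<close> itself showing that there
  are candidates.\<close>

lemma maximal_no_finite_cover:
  assumes "no_finite_cover L S"
  obtains M where "S \<subseteq> M" "no_finite_cover L M"
    "\<And>a. \<lbrakk>a \<in> carrier L; no_finite_cover L (insert a M)\<rbrakk> \<Longrightarrow> a \<in> M"
proof -
  let ?\<A> = "{M. S \<subseteq> M \<and> no_finite_cover L M}"
  have "\<Union>\<C> \<in> ?\<A>" if "\<C> \<noteq> {}" and chain: "subset.chain ?\<A> \<C>" for \<C>
  proof -
    have C: "S \<subseteq> M \<and> no_finite_cover L M" if "M \<in> \<C>" for M
      using chain that by (auto simp: subset.chain_def)
    have "no_finite_cover L (\<Union>\<C>)"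
      unfolding no_finite_cover_def
    proof (intro conjI allI impI)
      show "\<Union>\<C> \<subseteq> carrier L"
        using C by (auto simp: no_finite_cover_def)
    next
      fix F assume "F \<subseteq> \<Union>\<C>" "finite F"
      then obtain M where "M \<in> \<C>" "F \<subseteq> M"
        using finite_subset_Union_chain[OF _ _ \<open>\<C> \<noteq> {}\<close> chain] by metis
      then show "\<exists>u\<in>carrier L. u \<noteq> \<top>\<^bsub>L\<^esub> \<and> (\<forall>a\<in>F. a \<sqsubseteq>\<^bsub>L\<^esub> u)"
        using C \<open>finite F\<close> by (auto simp: no_finite_cover_def)
    qed
    then show ?thesis
      using C \<open>\<C> \<noteq> {}\<close> by blast
  qed
  moreover have "?\<A> \<noteq> {}"
    using assms by blast
  ultimately obtain M where "M \<in> ?\<A>" "\<forall>N\<in>?\<A>. M \<subseteq> N \<longrightarrow> N = M"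
    using subset_Zorn_nonempty[of ?\<A>] by blast
  then show thesis
    using that[of M] by blast
qed

context boolean_alg
begin

text \<open>This is the prime ideal theorem: a maximal \<open>M\<close> above \<open>S\<close> is a
  prime ideal, and the point is the indicator of its complement. In the trivial algebra even the
  empty set fails \<open>no_finite_cover\<close>, in accordance with the absence of points.\<close>

lemma stone_pt_avoiding:
  assumes "no_finite_cover L S"
  obtains x where "x \<in> stone_pts L" "\<And>a. a \<in> S \<Longrightarrow> \<not> x a"
proof -
  obtain M where M: "S \<subseteq> M" "no_finite_cover L M"
    and max: "\<And>a. \<lbrakk>a \<in> carrier L; no_finite_cover L (insert a M)\<rbrakk> \<Longrightarrow> a \<in> M"
    using maximal_no_finite_cover[OF assms] by blast
  have M_carrier: "a \<in> carrier L" if "a \<in> M" for a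
    using M(2) that by (auto simp: no_finite_cover_def)
  have bound: "\<exists>u\<in>carrier L. u \<noteq> \<top> \<and> (\<forall>a\<in>F. a \<sqsubseteq> u)" if "F \<subseteq> M" "finite F" for F
    using M(2) that by (auto simp: no_finite_cover_def)
  \<comment> \<open>Maximality in usable form: an element outside \<open>M\<close> forms a finite
    cover together with finitely many members of \<open>M\<close>. Each closure property below
    contradicts \<open>bound\<close> for a suitable enlargement of such a finite set.\<close>
  have cover: "\<exists>F\<subseteq>M. finite F \<and> (\<forall>u\<in>carrier L. (\<forall>b\<in>F. b \<sqsubseteq> u) \<longrightarrow> a \<sqsubseteq> u \<longrightarrow> u = \<top>)"
    if a: "a \<in> carrier L" "a \<notin> M" for a
  proof -
    have "\<not> no_finite_cover L (insert a M)"
      using max a by blast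
    moreover have "insert a M \<subseteq> carrier L"
      using M_carrier a by auto
    ultimately obtain F where F: "F \<subseteq> insert a M" "finite F"
      "\<not> (\<exists>u\<in>carrier L. u \<noteq> \<top> \<and> (\<forall>b\<in>F. b \<sqsubseteq> u))"
      unfolding no_finite_cover_def by meson
    \<comment> \<open>Removing \<open>a\<close> leaves a subset of \<open>M\<close>; the bound on
      \<open>a\<close> is the separate premise \<open>a \<sqsubseteq> u\<close>.\<close>
    show ?thesis
      by (rule exI[of _ "F - {a}"]) (use F in auto)
  qed
  have "\<top> \<notin> M"
    using bound[of "{\<top>}"] le_top_iff by auto
  have "\<bottom> \<in> M"
  proof (rule ccontr)
    assume "\<bottom> \<notin> M"
    then obtain F where F: "F \<subseteq> M" "finite F"
      "\<forall>u\<in>carrier L. (\<forall>b\<in>F. b \<sqsubseteq> u) \<longrightarrow> \<bottom> \<sqsubseteq> u \<longrightarrow> u = \<top>"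
      using cover[of \<bottom>] by auto
    show False
      using bound[OF F(1,2)] F(3) by auto
  qed
  have down: "b \<in> M" if ab: "a \<in> M" "b \<in> carrier L" "b \<sqsubseteq> a" for a b
  proof (rule ccontr)
    assume "b \<notin> M"
    then obtain F where F: "F \<subseteq> M" "finite F"
      "\<forall>u\<in>carrier L. (\<forall>c\<in>F. c \<sqsubseteq> u) \<longrightarrow> b \<sqsubseteq> u \<longrightarrow> u = \<top>"
      using cover[OF ab(2)] by auto
    obtain u where "u \<in> carrier L" "u \<noteq> \<top>" "\<forall>c\<in>insert a F. c \<sqsubseteq> u"
      using bound[of "insert a F"] F ab by auto
    then show False
      using F(3) ab M_carrier le_trans[of b a u] by auto
  qed
  have join: "a \<squnion> b \<in> M" if ab: "a \<in> M" "b \<in> M" for a b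
  proof (rule ccontr)
    have abL: "a \<in> carrier L" "b \<in> carrier L"
      using ab M_carrier by auto
    assume "a \<squnion> b \<notin> M"
    then obtain F where F: "F \<subseteq> M" "finite F"
      "\<forall>u\<in>carrier L. (\<forall>c\<in>F. c \<sqsubseteq> u) \<longrightarrow> a \<squnion> b \<sqsubseteq> u \<longrightarrow> u = \<top>"
      using cover[of "a \<squnion> b"] abL by auto
    obtain u where "u \<in> carrier L" "u \<noteq> \<top>" "\<forall>c\<in>insert a (insert b F). c \<sqsubseteq> u"
      using bound[of "insert a (insert b F)"] F ab by auto
    then show False
      using F(3) abL join_le[of a u b] by auto
  qed
  have prime: "a \<in> M \<or> b \<in> M" if ab: "a \<in> carrier L" "b \<in> carrier L" "a \<sqinter> b \<in> M" for a b
  proof (rule ccontr)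
    assume "\<not> (a \<in> M \<or> b \<in> M)"
    then obtain F G where F: "F \<subseteq> M" "finite F"
      "\<forall>u\<in>carrier L. (\<forall>c\<in>F. c \<sqsubseteq> u) \<longrightarrow> a \<sqsubseteq> u \<longrightarrow> u = \<top>"
      and G: "G \<subseteq> M" "finite G"
      "\<forall>u\<in>carrier L. (\<forall>c\<in>G. c \<sqsubseteq> u) \<longrightarrow> b \<sqsubseteq> u \<longrightarrow> u = \<top>"
      using cover[OF ab(1)] cover[OF ab(2)] by auto
    \<comment> \<open>A single \<open>u\<close> bounds both finite witnesses and
      \<open>a \<sqinter> b\<close>. The aim is \<open>a \<sqsubseteq> u\<close>, which with
      \<open>F\<close> would force \<open>u\<close> to be top.\<close>
    obtain u where u: "u \<in> carrier L" "u \<noteq> \<top>" "\<forall>c\<in>insert (a \<sqinter> b) (F \<union> G). c \<sqsubseteq> u"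
      using bound[of "insert (a \<sqinter> b) (F \<union> G)"] F G ab by auto
    have above: "c \<sqsubseteq> u \<squnion> d" if "c \<in> F \<union> G" "d \<in> carrier L" for c d
      using le_trans[of c u "u \<squnion> d"] join_left[of u d] u that F(1) G(1) M_carrier by auto
    \<comment> \<open>\<open>u \<squnion> b\<close> bounds \<open>G\<close> and \<open>b\<close>, so
      the choice of \<open>G\<close> makes it top; distributivity then places \<open>a\<close> below
      \<open>u\<close>.\<close>
    have "u \<squnion> b = \<top>"
      using G(3) above ab join_right[of u b] u by auto
    then have "a = a \<sqinter> (u \<squnion> b)"
      using top_meet[of a] ab by (simp add: eq_is_equal meet_comm)
    also have "\<dots> = (a \<sqinter> u) \<squnion> (a \<sqinter> b)"
      using ab u by (simp add: distrib)
    also have "\<dots> \<sqsubseteq> u"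
      using ab u by (intro join_le meet_right) auto
    finally have "a \<sqsubseteq> u" .
    then show False
      using F(3) u by auto
  qed
  define x where "x = (\<lambda>a\<in>carrier L. a \<notin> M)"
  have "x \<in> stone_pts L"
    unfolding stone_pts_def
  proof (rule bool_homI)
    show "x \<bottom> = \<bottom>\<^bsub>two_alg\<^esub>" "x \<top> = \<top>\<^bsub>two_alg\<^esub>"
      using \<open>\<bottom> \<in> M\<close> \<open>\<top> \<notin> M\<close> by (auto simp: x_def)
  next
    fix a b assume ab: "a \<in> carrier L" "b \<in> carrier L"
    show "x (a \<squnion> b) = x a \<squnion>\<^bsub>two_alg\<^esub> x b"
      using join down[OF _ ab(1) join_left[OF ab]] down[OF _ ab(2) join_right[OF ab]] ab
      by (auto simp: x_def)
    show "x (a \<sqinter> b) = x a \<sqinter>\<^bsub>two_alg\<^esub> x b"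
      using prime[OF ab] down[OF _ _ meet_left[OF ab]] down[OF _ _ meet_right[OF ab]] ab
      by (auto simp: x_def)
  qed (auto simp: x_def boolean_alg_axioms boolean_alg_two_alg)
  moreover have "\<not> x a" if "a \<in> S" for a
    using that M(1) M_carrier by (auto simp: x_def)
  ultimately show thesis
    using that by blast
qed

text \<open>If \<open>a\<close> is not below \<open>b\<close>, then
  \<open>b \<squnion> bcompl L a\<close> is not top, so some point vanishes at both \<open>b\<close>
  and \<open>bcompl L a\<close>. Such a point takes the value 1 at \<open>a\<close>.\<close>

lemma stone_pt_separating:
  assumes a: "a \<in> carrier L" and b: "b \<in> carrier L" and "\<not> a \<sqsubseteq> b"
  obtains x where "x \<in> stone_pts L" "x a" "\<not> x b"
proof -
  let ?u = "b \<squnion> bcompl L a"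
  have "?u \<noteq> \<top>"
    using complement_le[of "bcompl L a" a b] assms
    by (metis bcompl_closed join_comm meet_bcompl meet_comm)
  moreover have "b \<sqsubseteq> ?u" "bcompl L a \<sqsubseteq> ?u"
    using a b by (simp_all add: join_left join_right)
  ultimately have "\<exists>u\<in>carrier L. u \<noteq> \<top> \<and> (\<forall>c\<in>{b, bcompl L a}. c \<sqsubseteq> u)"
    using a b by (intro bexI[of _ ?u]) simp_all
  then have "no_finite_cover L {b, bcompl L a}"
    using a b unfolding no_finite_cover_def by (meson bcompl_closed empty_subsetI insert_subset subsetD)
  then obtain x where x: "x \<in> stone_pts L" "\<not> x b" "\<not> x (bcompl L a)"
    using stone_pt_avoiding by (metis insertCI)
  have "x a"
  proof -
    have "x (a \<squnion> bcompl L a) = x a \<squnion>\<^bsub>two_alg\<^esub> x (bcompl L a)"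
      using x(1) a by (intro bool_homD(2)) (auto simp: stone_pts_def)
    then show ?thesis
      using a x bool_homD(5)[of x L two_alg] by (simp add: stone_pts_def)
  qed
  with x that show thesis
    by blast
qed

section \<open>The representation of the algebra by sets of points\<close>

lemma
  assumes "a \<in> carrier L" "b \<in> carrier L"
  shows stone_set_join: "stone_set L (a \<squnion> b) = stone_set L a \<union> stone_set L b"
    and stone_set_meet: "stone_set L (a \<sqinter> b) = stone_set L a \<inter> stone_set L b"
proof -
  have "x (a \<squnion> b) \<longleftrightarrow> x a \<or> x b" "x (a \<sqinter> b) \<longleftrightarrow> x a \<and> x b" if "x \<in> stone_pts L" for x
    using that assms bool_homD(2,3)[of x L two_alg a b] by (simp_all add: stone_pts_def)
  then show "stone_set L (a \<squnion> b) = stone_set L a \<union> stone_set L b"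
    "stone_set L (a \<sqinter> b) = stone_set L a \<inter> stone_set L b"
    by (auto simp: stone_set_def)
qed

lemma stone_set_top: "stone_set L \<top> = stone_pts L"
  and stone_set_bottom: "stone_set L \<bottom> = {}"
proof -
  have "x \<top> \<and> \<not> x \<bottom>" if "x \<in> stone_pts L" for x
    using that bool_homD(4,5)[of x L two_alg] by (simp add: stone_pts_def)
  then show "stone_set L \<top> = stone_pts L" "stone_set L \<bottom> = {}"
    by (auto simp: stone_set_def)
qed

lemma stone_set_bcompl: "a \<in> carrier L \<Longrightarrow> stone_set L (bcompl L a) = stone_pts L - stone_set L a"
  using stone_set_join[of a "bcompl L a"] stone_set_meet[of a "bcompl L a"]
  by (auto simp: stone_set_top stone_set_bottom)

lemma stone_set_inj: "inj_on (stone_set L) (carrier L)"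
proof (rule inj_onI)
  have le: "a \<sqsubseteq> b" if ab: "a \<in> carrier L" "b \<in> carrier L" "stone_set L a = stone_set L b" for a b
  proof (rule ccontr)
    assume "\<not> a \<sqsubseteq> b"
    then obtain x where "x \<in> stone_pts L" "x a" "\<not> x b"
      using stone_pt_separating[OF ab(1,2)] by metis
    then have "x \<in> stone_set L a" "x \<notin> stone_set L b"
      by (simp_all add: stone_set_def)
    with ab(3) show False
      by simp
  qed
  fix a b assume "a \<in> carrier L" "b \<in> carrier L" "stone_set L a = stone_set L b"
  then show "a = b"
    using le[of a b] le[of b a] by (intro le_antisym) simp_all
qed

text \<open>The witness is the join of \<open>F\<close>, built by induction. Its being an upper
  bound links finite unions of basic sets to \<open>no_finite_cover\<close>.\<close>

lemma stone_set_finite_Union: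
  assumes "finite F" "F \<subseteq> carrier L"
  shows "\<exists>c\<in>carrier L. (\<forall>a\<in>F. a \<sqsubseteq> c) \<and> stone_set L c = (\<Union>a\<in>F. stone_set L a)"
  using assms
proof induction
  case empty
  show ?case
    by (rule bexI[of _ \<bottom>]) (auto simp: stone_set_bottom)
next
  case (insert a F)
  then obtain c where c: "c \<in> carrier L" "\<forall>b\<in>F. b \<sqsubseteq> c" "stone_set L c = (\<Union>b\<in>F. stone_set L b)"
    by auto
  have "b \<sqsubseteq> a \<squnion> c" if "b \<in> insert a F" for b
    using that insert.prems c join_left[of a c] join_right[of a c] le_trans[of b c "a \<squnion> c"] by auto
  then show ?case
    using c insert.prems by (intro bexI[of _ "a \<squnion> c"]) (auto simp: stone_set_join)
qed

section \<open>The Stone topology and its clopen sets\<close>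

lemma openin_stone_space:
  "openin (stone_space L) U \<longleftrightarrow> (\<exists>S\<subseteq>carrier L. U = (\<Union>a\<in>S. stone_set L a))"
proof -
  have "istopology (arbitrary union_of (\<lambda>U. U \<in> stone_set L ` carrier L))"
    by (rule istopology_base) (auto simp flip: stone_set_meet)
  then have "openin (stone_space L) U \<longleftrightarrow> (\<exists>\<U>\<subseteq>stone_set L ` carrier L. U = \<Union>\<U>)"
    by (auto simp: stone_space_def topology_inverse' union_of_def arbitrary_def)
  then show ?thesis
    by (auto simp: subset_image_iff)
qed

lemma topspace_stone_space: "topspace (stone_space L) = stone_pts L"
proof (rule equalityI)
  have "openin (stone_space L) (stone_pts L)"
    unfolding openin_stone_space by (intro exI[of _ "{\<top>}"]) (auto simp: stone_set_top)
  then show "stone_pts L \<subseteq> topspace (stone_space L)"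
    by (rule openin_subset)
  show "topspace (stone_space L) \<subseteq> stone_pts L"
    using openin_topspace[of "stone_space L"] unfolding openin_stone_space
    by (auto simp: stone_set_def)
qed

text \<open>Compactness makes a clopen set basic: finitely many basic sets inside \<open>U\<close>
  and finitely many inside its complement cover the space, so the former already fill
  \<open>U\<close>. Conversely, complements of basic sets are basic.\<close>

lemma clopens_stone_space: "clopens (stone_space L) = stone_set L ` carrier L"
proof (intro equalityI subsetI)
  fix U assume "U \<in> clopens (stone_space L)"
  then have "openin (stone_space L) U" "openin (stone_space L) (stone_pts L - U)"
    and U: "U \<subseteq> stone_pts L"
    by (auto simp: clopens_def closedin_def topspace_stone_space)
  then obtain S T where S: "S \<subseteq> carrier L" "U = (\<Union>a\<in>S. stone_set L a)"
    and T: "T \<subseteq> carrier L" "stone_pts L - U = (\<Union>a\<in>T. stone_set L a)"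
    unfolding openin_stone_space by blast
  \<comment> \<open>A point avoiding all indices would lie neither in \<open>U\<close> nor in its
    complement. The resulting finite \<open>F\<close>, with top as its only upper bound, is a finite
    subcover in algebraic form.\<close>
  have "\<not> no_finite_cover L (S \<union> T)"
  proof
    assume "no_finite_cover L (S \<union> T)"
    then obtain x where "x \<in> stone_pts L" "\<And>a. a \<in> S \<union> T \<Longrightarrow> \<not> x a"
      by (rule stone_pt_avoiding) simp
    then have "x \<notin> (\<Union>a\<in>S. stone_set L a)" "x \<notin> (\<Union>a\<in>T. stone_set L a)"
      by (auto simp: stone_set_def)
    then have "x \<notin> U" "x \<notin> stone_pts L - U"
      by (simp_all only: S(2)[symmetric] T(2)[symmetric] not_False_eq_True)
    with \<open>x \<in> stone_pts L\<close> show False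
      by blast
  qed
  then obtain F where F: "F \<subseteq> S \<union> T" "finite F"
    and "\<not> (\<exists>u\<in>carrier L. u \<noteq> \<top> \<and> (\<forall>a\<in>F. a \<sqsubseteq> u))"
    using S(1) T(1) unfolding no_finite_cover_def by (meson Un_least)
  then have cover: "u = \<top>" if "u \<in> carrier L" "\<forall>a\<in>F. a \<sqsubseteq> u" for u
    using that by blast
  obtain c where c: "c \<in> carrier L" "\<forall>a\<in>F \<inter> S. a \<sqsubseteq> c" "stone_set L c = (\<Union>a\<in>F \<inter> S. stone_set L a)"
    using stone_set_finite_Union[of "F \<inter> S"] F(2) S(1) by (meson finite_Int le_infI2)
  obtain d where d: "d \<in> carrier L" "\<forall>a\<in>F \<inter> T. a \<sqsubseteq> d" "stone_set L d = (\<Union>a\<in>F \<inter> T. stone_set L a)"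
    using stone_set_finite_Union[of "F \<inter> T"] F(2) T(1) by (meson finite_Int le_infI2)
  have "c \<squnion> d = \<top>"
  proof (rule cover)
    show "\<forall>a\<in>F. a \<sqsubseteq> c \<squnion> d"
    proof
      fix a assume "a \<in> F"
      then have "a \<in> carrier L" "a \<sqsubseteq> c \<or> a \<sqsubseteq> d"
        using F S(1) T(1) c(2) d(2) by auto
      then show "a \<sqsubseteq> c \<squnion> d"
        using c(1) d(1) le_trans[of a _ "c \<squnion> d"] join_left[of c d] join_right[of c d] by auto
    qed
  qed (use c d in auto)
  then have "stone_set L c \<union> stone_set L d = stone_pts L"
    using c(1) d(1) by (simp flip: stone_set_join add: stone_set_top)
  moreover have "stone_set L c \<subseteq> U"
    unfolding S(2) c(3) by auto
  moreover have "stone_set L d \<subseteq> stone_pts L - U"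
    unfolding T(2) d(3) by auto
  \<comment> \<open>The sets of \<open>c\<close> and \<open>d\<close> cover all points and lie on
    opposite sides of \<open>U\<close>, so both inclusions are equalities.\<close>
  ultimately have "U = stone_set L c"
    using U by blast
  with c(1) show "U \<in> stone_set L ` carrier L"
    by blast
next
  fix U assume "U \<in> stone_set L ` carrier L"
  then obtain a where a: "a \<in> carrier L" "U = stone_set L a"
    by blast
  have basic: "openin (stone_space L) (stone_set L b)" if "b \<in> carrier L" for b
    unfolding openin_stone_space using that by (intro exI[of _ "{b}"]) simp
  have "openin (stone_space L) (stone_pts L - U)"
    using basic[of "bcompl L a"] a by (simp add: stone_set_bcompl)
  moreover have "U \<subseteq> stone_pts L"
    using a by (auto simp: stone_set_def)
  ultimately show "U \<in> clopens (stone_space L)"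
    using basic[of a] a by (simp add: clopens_def closedin_def topspace_stone_space)
qed

end


section \<open>Compact mz-maps\<close>

lemma stone_map_eq: "a \<in> carrier A \<Longrightarrow> stone_map A (stone_pts A) a = stone_set A a"
  by (auto simp: stone_map_def stone_set_def)

lemma stone_map_image: "stone_map A (stone_pts A) ` carrier A = stone_set A ` carrier A"
  by (rule image_cong) (simp_all add: stone_map_eq)

lemma stone_map_bool_hom:
  assumes "boolean_alg A"
  shows "stone_map A (stone_pts A) \<in> bool_hom A (pow_alg (stone_pts A))"
proof -
  interpret boolean_alg A by fact
  have sub: "stone_set A a \<subseteq> stone_pts A" for a
    by (auto simp: stone_set_def)
  show ?thesis
    by (rule bool_homI)
      (auto simp: assms boolean_alg_pow_alg stone_map_eq stone_set_join stone_set_meet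
        join_pow_alg meet_pow_alg stone_set_bottom stone_set_top sub,
        auto simp: stone_map_def stone_set_def)
qed

text \<open>Points are indicators of ultrafilters, so inclusion implies equality: if
  \<open>x\<close> vanishes at \<open>a\<close>, it is 1 at the complement, hence so is
  \<open>y\<close>, and \<open>y\<close> vanishes at \<open>a\<close>.\<close>

lemma stone_pt_eqI:
  assumes "x \<in> stone_pts A" "y \<in> stone_pts A" and imp: "\<And>a. \<lbrakk>a \<in> carrier A; x a\<rbrakk> \<Longrightarrow> y a"
    and A: "boolean_alg A"
  shows "x = y"
proof -
  interpret boolean_alg A by fact
  have x: "x \<in> carrier A \<rightarrow>\<^sub>E UNIV" and y: "y \<in> carrier A \<rightarrow>\<^sub>E UNIV"
    using assms(1,2) by (auto simp: stone_pts_def dest: bool_homD(1))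
  show ?thesis
  proof (rule PiE_ext[OF x y])
    fix a assume a: "a \<in> carrier A"
    have "x a \<or> x (bcompl A a)"
      using assms(1) a bool_homD(2)[of x A two_alg a "bcompl A a"] bool_homD(5)[of x A two_alg]
      by (simp add: stone_pts_def)
    moreover have "\<not> (y a \<and> y (bcompl A a))"
      using assms(2) a bool_homD(3)[of y A two_alg a "bcompl A a"] bool_homD(4)[of y A two_alg]
      by (simp add: stone_pts_def)
    ultimately show "x a = y a"
      using imp[of a] imp[of "bcompl A a"] a by auto
  qed
qed

text \<open>This gives the meet condition of a z-map for \<open>P(X\<^sub>A)\<close>, and later lets
  a complete homomorphism be computed on singletons.\<close>

lemma singleton_eq_Inter_stone_sets:
  assumes "boolean_alg A" "x \<in> stone_pts A"
  shows "{x} = stone_pts A \<inter> \<Inter>(stone_set A ` {a \<in> carrier A. x a})"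
proof (intro equalityI subsetI)
  fix y assume "y \<in> stone_pts A \<inter> \<Inter>(stone_set A ` {a \<in> carrier A. x a})"
  then have "x = y"
    using assms by (intro stone_pt_eqI[of x A y]) (auto simp: stone_set_def)
  then show "y \<in> {x}"
    by simp
qed (use assms in \<open>auto simp: stone_set_def\<close>)

text \<open>The atom \<open>{x}\<close> lies below \<open>stone_set A a\<close> exactly when
  \<open>x a\<close>, so it induces \<open>x\<close> itself. The subspace in the definition of an
  mz-map is therefore the full Stone space.\<close>

lemma atom_pts_stone_map: "atom_pts A (pow_alg (stone_pts A)) (stone_map A (stone_pts A)) = stone_pts A"
proof -
  have "atom_pt A (pow_alg (stone_pts A)) (stone_map A (stone_pts A)) {x} = x"
    if "x \<in> stone_pts A" for x
  proof -
    have "x \<in> carrier A \<rightarrow>\<^sub>E UNIV"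
      using that bool_homD(1)[of x A two_alg] by (simp add: stone_pts_def)
    then have "x = restrict x (carrier A)"
      by (simp add: PiE_restrict)
    also have "\<dots> = atom_pt A (pow_alg (stone_pts A)) (stone_map A (stone_pts A)) {x}"
      unfolding atom_pt_def
      by (rule restrict_ext) (use that in \<open>auto simp: stone_map_eq stone_set_def\<close>)
    finally show ?thesis ..
  qed
  then show ?thesis
    by (auto simp: atom_pts_def atoms_pow_alg image_image)
qed

lemma mz_map_stone_map:
  assumes A: "boolean_alg A"
  shows "mz_map A (pow_alg (stone_pts A)) (stone_map A (stone_pts A))"
proof -
  interpret boolean_alg A by fact
  have "\<exists>S\<subseteq>stone_map A (stone_pts A) ` carrier A. U = \<Sqinter>\<^bsub>pow_alg (stone_pts A)\<^esub>S"
    if U: "U \<in> atoms (pow_alg (stone_pts A))" for U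
  proof -
    obtain x where x: "x \<in> stone_pts A" "U = {x}"
      using U by (auto simp: atoms_pow_alg)
    let ?S = "stone_set A ` {a \<in> carrier A. x a}"
    have "?S \<subseteq> Pow (stone_pts A)"
      by (auto simp: stone_set_def)
    then have "U = \<Sqinter>\<^bsub>pow_alg (stone_pts A)\<^esub>?S"
      using singleton_eq_Inter_stone_sets[OF A x(1)] x(2) by (simp only: inf_pow_alg)
    then show ?thesis
      unfolding stone_map_image by (intro exI[of _ ?S]) auto
  qed
  moreover have "inj_on (stone_map A (stone_pts A)) (carrier A)"
    using stone_set_inj by (simp add: inj_on_def stone_map_eq)
  moreover have "subtopology (stone_space A) (stone_pts A) = stone_space A"
    by (metis subtopology_topspace topspace_stone_space)
  ultimately show ?thesis
    by (auto simp: mz_map_def z_map_def A caba_pow_alg stone_map_bool_hom[OF A]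
        atom_pts_stone_map clopens_stone_space stone_map_image)
qed

text \<open>Agreement spreads from basic sets to singletons through arbitrary meets, and from
  singletons to all sets through arbitrary joins.\<close>

lemma complete_bool_hom_stone_ext:
  assumes A: "boolean_alg A"
    and \<sigma>: "\<sigma> \<in> complete_bool_hom (pow_alg (stone_pts A)) B"
    and \<tau>: "\<tau> \<in> complete_bool_hom (pow_alg (stone_pts A)) B"
    and eq: "\<And>a. a \<in> carrier A \<Longrightarrow> \<sigma> (stone_set A a) = \<tau> (stone_set A a)"
  shows "\<sigma> = \<tau>"
proof (rule PiE_ext)
  show "\<sigma> \<in> Pow (stone_pts A) \<rightarrow>\<^sub>E carrier B" "\<tau> \<in> Pow (stone_pts A) \<rightarrow>\<^sub>E carrier B"
    using bool_homD(1)[OF complete_bool_homD(1)[OF \<sigma>]] bool_homD(1)[OF complete_bool_homD(1)[OF \<tau>]]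
    by simp_all
next
  have atom: "\<sigma> {x} = \<tau> {x}" if "x \<in> stone_pts A" for x
  proof -
    let ?S = "stone_set A ` {a \<in> carrier A. x a}"
    have S: "?S \<subseteq> Pow (stone_pts A)"
      by (auto simp: stone_set_def)
    have "{x} = \<Sqinter>\<^bsub>pow_alg (stone_pts A)\<^esub>?S"
      using singleton_eq_Inter_stone_sets[OF A that] inf_pow_alg[OF S] by simp
    moreover have "\<sigma> ` ?S = \<tau> ` ?S"
      unfolding image_image by (rule image_cong) (use eq in auto)
    ultimately show ?thesis
      using complete_bool_homD(5)[OF \<sigma>, of ?S] complete_bool_homD(5)[OF \<tau>, of ?S] S by simp
  qed
  fix U assume U: "U \<in> Pow (stone_pts A)"
  let ?S = "(\<lambda>x. {x}) ` U"
  have S: "?S \<subseteq> Pow (stone_pts A)"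
    using U by auto
  have "U = \<Squnion>\<^bsub>pow_alg (stone_pts A)\<^esub>?S"
    using sup_pow_alg[OF S] by simp
  moreover have "\<sigma> ` ?S = \<tau> ` ?S"
    unfolding image_image by (rule image_cong) (use atom U in auto)
  ultimately show "\<sigma> U = \<tau> U"
    using complete_bool_homD(4)[OF \<sigma>, of ?S] complete_bool_homD(4)[OF \<tau>, of ?S] S by simp
qed

text \<open>The preimage operation of the Stone dual of \<phi>. Composing over
  \<open>carrier A\<close> keeps the pulled back point extensional, as membership in
  \<open>stone_pts A\<close> demands.\<close>

definition stone_lift ::
  "'a gorder \<Rightarrow> 'b gorder \<Rightarrow> ('a \<Rightarrow> 'b) \<Rightarrow> ('a \<Rightarrow> bool) set \<Rightarrow> ('b \<Rightarrow> bool) set" where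
  "stone_lift A B \<phi> =
     (\<lambda>U\<in>Pow (stone_pts A). {y \<in> stone_pts B. compose (carrier A) y \<phi> \<in> U})"

lemma compose_stone_pt:
  assumes "boolean_alg A" "\<phi> \<in> bool_hom A B" "y \<in> stone_pts B"
  shows "compose (carrier A) y \<phi> \<in> stone_pts A"
  using compose_bool_hom[OF assms(1) boolean_alg_two_alg assms(2)] assms(3)
  by (simp add: stone_pts_def)

lemma stone_lift_complete_bool_hom:
  assumes "boolean_alg A" "\<phi> \<in> bool_hom A B"
  shows "stone_lift A B \<phi> \<in> complete_bool_hom (pow_alg (stone_pts A)) (pow_alg (stone_pts B))"
  unfolding stone_lift_def
  by (rule preimage_complete_bool_hom) (use assms compose_stone_pt in blast)

text \<open>The lift and \<phi> form a commuting square with the two Stone maps, because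
  \<open>y\<close> composed with \<phi> is 1 at \<open>a\<close> exactly when \<open>y\<close> is 1
  at \<open>\<phi> a\<close>.\<close>

lemma stone_lift_stone_set:
  assumes "boolean_alg A" "\<phi> \<in> bool_hom A B" "a \<in> carrier A"
  shows "stone_lift A B \<phi> (stone_set A a) = stone_set B (\<phi> a)"
  using assms compose_stone_pt[OF assms(1,2)]
  by (auto simp: stone_lift_def stone_set_def compose_def)

lemma stone_lift_unique:
  assumes "boolean_alg A" "\<phi> \<in> bool_hom A B"
    and "\<sigma> \<in> complete_bool_hom (pow_alg (stone_pts A)) (pow_alg (stone_pts B))"
    and "\<And>a. a \<in> carrier A \<Longrightarrow> \<sigma> (stone_set A a) = stone_set B (\<phi> a)"
  shows "stone_lift A B \<phi> = \<sigma>"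
  by (rule complete_bool_hom_stone_ext[OF assms(1) stone_lift_complete_bool_hom[OF assms(1,2)] assms(3)])
    (use assms in \<open>simp add: stone_lift_stone_set\<close>)


section \<open>The categories\<close>

lemma compose_restrict_id_right: "f \<in> S \<rightarrow>\<^sub>E T \<Longrightarrow> compose S f (restrict id S) = f"
  by (rule extensionalityI[of _ S]) (auto simp: compose_def PiE_def)

lemma compose_restrict_id_left: "f \<in> S \<rightarrow>\<^sub>E T \<Longrightarrow> compose S (restrict id T) f = f"
  by (rule extensionalityI[of _ S]) (auto simp: compose_def PiE_def)

lemma compose_assoc_PiE: "f \<in> S \<rightarrow>\<^sub>E T \<Longrightarrow> compose S h (compose S g f) = compose S (compose T h g) f"
  using compose_assoc[of f S T h g] by (auto simp: PiE_def)

lemma category_Boole: "category Boole"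
proof
  fix A B C D :: "'a gorder" and f g h
  assume "f \<in> Hom Boole A B" "g \<in> Hom Boole B C" "h \<in> Hom Boole C D"
  then have "f \<in> carrier A \<rightarrow>\<^sub>E carrier B"
    by (simp add: Boole_def bool_homD)
  then show "Cmp Boole A C D h (Cmp Boole A B C g f) = Cmp Boole A B D (Cmp Boole B C D h g) f"
    by (simp add: Boole_def compose_assoc_PiE)
qed (auto simp: Boole_def restrict_id_bool_hom compose_bool_hom
    intro!: compose_restrict_id_right compose_restrict_id_left dest: bool_homD(1))

text \<open>The laws hold componentwise; the substance is that commuting squares paste
  together.\<close>

lemma category_mzMaps: "category mzMaps"
proof
  fix m n k l :: "('a, 'b) alg_map" and f g h
  assume f: "f \<in> Hom mzMaps m n" and g: "g \<in> Hom mzMaps n k" and h: "h \<in> Hom mzMaps k l"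
  obtain \<phi> \<sigma> \<psi> \<tau> \<chi> \<upsilon> where [simp]: "f = (\<phi>, \<sigma>)" "g = (\<psi>, \<tau>)" "h = (\<chi>, \<upsilon>)"
    by (meson surj_pair)
  have "\<phi> \<in> carrier (Dom m) \<rightarrow>\<^sub>E carrier (Dom n)" "\<sigma> \<in> carrier (Cod m) \<rightarrow>\<^sub>E carrier (Cod n)"
    using f by (auto simp: mzMaps_def dest: bool_homD(1) complete_bool_homD(1))
  then show "Cmp mzMaps m k l h (Cmp mzMaps m n k g f) = Cmp mzMaps m n l (Cmp mzMaps n k l h g) f"
    by (simp add: mzMaps_def compose_assoc_PiE)
next
  fix m n k :: "('a, 'b) alg_map" and f g
  assume obj: "m \<in> Obj mzMaps" "n \<in> Obj mzMaps" "k \<in> Obj mzMaps"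
    and f: "f \<in> Hom mzMaps m n" and g: "g \<in> Hom mzMaps n k"
  obtain \<phi> \<sigma> \<psi> \<tau> where [simp]: "f = (\<phi>, \<sigma>)" "g = (\<psi>, \<tau>)"
    by (meson surj_pair)
  \<comment> \<open>Equality of the extensional composites is read as commutation of the square at
    each element of the carrier.\<close>
  have f': "\<phi> \<in> bool_hom (Dom m) (Dom n)" "\<sigma> \<in> complete_bool_hom (Cod m) (Cod n)"
    "\<And>a. a \<in> carrier (Dom m) \<Longrightarrow> Fun n (\<phi> a) = \<sigma> (Fun m a)"
    using f by (auto simp: mzMaps_def compose_def restrict_def fun_eq_iff split: if_splits)
  have g': "\<psi> \<in> bool_hom (Dom n) (Dom k)" "\<tau> \<in> complete_bool_hom (Cod n) (Cod k)"
    "\<And>a. a \<in> carrier (Dom n) \<Longrightarrow> Fun k (\<psi> a) = \<tau> (Fun n a)"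
    using g by (auto simp: mzMaps_def compose_def restrict_def fun_eq_iff split: if_splits)
  have "compose (carrier (Dom m)) (Fun k) (compose (carrier (Dom m)) \<psi> \<phi>) =
    compose (carrier (Dom m)) (compose (carrier (Cod m)) \<tau> \<sigma>) (Fun m)"
  proof (rule extensionalityI)
    fix a assume a: "a \<in> carrier (Dom m)"
    then have "\<phi> a \<in> carrier (Dom n)" "Fun m a \<in> carrier (Cod m)"
      using f'(1) obj(1) by (auto simp: mzMaps_def mz_map_def z_map_def bool_hom_closed)
    then show "compose (carrier (Dom m)) (Fun k) (compose (carrier (Dom m)) \<psi> \<phi>) a =
      compose (carrier (Dom m)) (compose (carrier (Cod m)) \<tau> \<sigma>) (Fun m) a"
      using a f'(3) g'(3) by (simp add: compose_eq)
  qed auto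
  then show "Cmp mzMaps m n k g f \<in> Hom mzMaps m k"
    using f' g' obj
    by (auto simp: mzMaps_def mz_map_def z_map_def cabaD
        intro!: compose_bool_hom compose_complete_bool_hom)
next
  fix m :: "('a, 'b) alg_map" assume "m \<in> Obj mzMaps"
  then have m: "boolean_alg (Dom m)" "caba (Cod m)" "Fun m \<in> bool_hom (Dom m) (Cod m)"
    by (auto simp: mzMaps_def mz_map_def z_map_def)
  then show "Idt mzMaps m \<in> Hom mzMaps m m"
    using bool_homD(1)[OF m(3)]
    by (auto simp: mzMaps_def restrict_id_bool_hom restrict_id_complete_bool_hom
        compose_restrict_id_left compose_restrict_id_right)
qed (auto simp: mzMaps_def
    intro!: compose_restrict_id_right compose_restrict_id_left dest: bool_homD(1) complete_bool_homD(1))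

section \<open>The category of compact mz-maps and its hom-sets\<close>

lemma category_full_subcat:
  assumes "category C"
  shows "category (full_subcat C P)"
proof -
  interpret category C by fact
  show ?thesis
    by standard
      (simp_all add: full_subcat_def Idt_in_Hom Cmp_in_Hom Cmp_Idt_right Cmp_Idt_left Cmp_assoc)
qed

lemma category_kMaps: "category kMaps"
  unfolding kMaps_def by (intro category_full_subcat category_mzMaps)

text \<open>By \<open>mz_map_stone_map\<close> every compact map is already an object of
  \<open>mzMaps\<close>, so passing to the full subcategory loses none of them.\<close>

lemma Obj_kMaps: "Obj kMaps = {compact_map A |A. boolean_alg A}"
  by (auto simp: kMaps_def full_subcat_def mzMaps_def compact_map_def mz_map_stone_map)

text \<open>Existence and uniqueness of the lift turn the hom-set into the graph of
  \<open>stone_lift A B\<close>; the first projection is thus bijective onto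
  \<open>bool_hom A B\<close>.\<close>

lemma Hom_kMaps:
  assumes A: "boolean_alg A" and B: "boolean_alg B"
  shows "Hom kMaps (compact_map A) (compact_map B) = (\<lambda>\<phi>. (\<phi>, stone_lift A B \<phi>)) ` bool_hom A B"
proof -
  have "(\<phi>, \<sigma>) \<in> Hom kMaps (compact_map A) (compact_map B) \<longleftrightarrow>
    \<phi> \<in> bool_hom A B \<and> \<sigma> = stone_lift A B \<phi>" for \<phi> \<sigma>
  proof -
    have "(\<phi>, \<sigma>) \<in> Hom kMaps (compact_map A) (compact_map B) \<longleftrightarrow>
      \<phi> \<in> bool_hom A B \<and> \<sigma> \<in> complete_bool_hom (pow_alg (stone_pts A)) (pow_alg (stone_pts B)) \<and>
      compose (carrier A) (stone_map B (stone_pts B)) \<phi> =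
      compose (carrier A) \<sigma> (stone_map A (stone_pts A))"
      by (simp add: kMaps_def full_subcat_def mzMaps_def compact_map_def)
    \<comment> \<open>Evaluating the square on \<open>carrier A\<close> replaces Stone maps by Stone
      sets, which is the form in which the lift is characterised.\<close>
    also have "\<dots> \<longleftrightarrow> \<phi> \<in> bool_hom A B \<and>
      \<sigma> \<in> complete_bool_hom (pow_alg (stone_pts A)) (pow_alg (stone_pts B)) \<and>
      (\<forall>a\<in>carrier A. \<sigma> (stone_set A a) = stone_set B (\<phi> a))"
      by (auto simp: compose_def restrict_def fun_eq_iff stone_map_eq bool_hom_closed
          split: if_splits)
    also have "\<dots> \<longleftrightarrow> \<phi> \<in> bool_hom A B \<and> \<sigma> = stone_lift A B \<phi>"
      using stone_lift_unique[OF A] stone_lift_complete_bool_hom[OF A] stone_lift_stone_set[OF A]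
      by blast
    finally show ?thesis .
  qed
  then show ?thesis
    by auto
qed

lemma Idt_kMaps:
  "Idt kMaps (compact_map A) = (restrict id (carrier A), restrict id (Pow (stone_pts A)))"
  by (simp add: kMaps_def full_subcat_def mzMaps_def compact_map_def)

lemma Cmp_kMaps:
  "Cmp kMaps (compact_map A) (compact_map B) (compact_map C) (\<psi>, \<tau>) (\<phi>, \<sigma>) =
    (compose (carrier A) \<psi> \<phi>, compose (Pow (stone_pts A)) \<tau> \<sigma>)"
  by (simp add: kMaps_def full_subcat_def mzMaps_def compact_map_def)

text \<open>An object records its domain, so the algebra is recovered on the nose. This gives an
  isomorphism of categories and not merely an equivalence.\<close>

lemma Dom_compact_map [simp]: "Dom (compact_map A) = A"
  by (simp add: compact_map_def)

theorem proposition5p3: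
  shows "isomorphic_cats (Boole :: ('a gorder, 'a \<Rightarrow> 'a) cat)
    (kMaps :: (('a, ('a \<Rightarrow> bool) set) alg_map,
               ('a \<Rightarrow> 'a) \<times> (('a \<Rightarrow> bool) set \<Rightarrow> ('a \<Rightarrow> bool) set)) cat)"
proof -
  interpret kMaps: category "kMaps :: (('a, ('a \<Rightarrow> bool) set) alg_map,
               ('a \<Rightarrow> 'a) \<times> (('a \<Rightarrow> bool) set \<Rightarrow> ('a \<Rightarrow> bool) set)) cat"
    by (rule category_kMaps)
  have Boole: "Obj Boole = {A :: 'a gorder. boolean_alg A}" "Hom Boole = bool_hom"
    "Idt Boole = (\<lambda>A :: 'a gorder. restrict id (carrier A))"
    "Cmp Boole = (\<lambda>(A :: 'a gorder) B C g f. compose (carrier A) g f)"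
    by (simp_all add: Boole_def)
  let ?Fm = "\<lambda>A B \<phi>. (\<phi>, stone_lift A B \<phi>) :: ('a \<Rightarrow> 'a) \<times> (('a \<Rightarrow> bool) set \<Rightarrow> ('a \<Rightarrow> bool) set)"
  have Hom: "?Fm A B \<phi> \<in> Hom kMaps (compact_map A) (compact_map B)"
    if "boolean_alg A" "boolean_alg B" "\<phi> \<in> bool_hom A B" for A B \<phi>
    using that by (simp add: Hom_kMaps)
  text \<open>Since a morphism of compact mz-maps is determined by its first component, functoriality
    only has to be checked there.\<close>
  have eqI: "u = v"
    if "u \<in> Hom kMaps (compact_map A) (compact_map B)" "v \<in> Hom kMaps (compact_map A) (compact_map B)"
      "fst u = fst v" "boolean_alg A" "boolean_alg B" for u v and A B :: "'a gorder"
    using that by (auto simp: Hom_kMaps)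
  have "cat_functor Boole kMaps compact_map ?Fm"
  proof (intro cat_functor.intro cat_functor_axioms.intro category_Boole category_kMaps)
    fix A :: "'a gorder" assume "A \<in> Obj Boole"
    then have A: "boolean_alg A"
      by (simp add: Boole)
    show "?Fm A A (Idt Boole A) = Idt kMaps (compact_map A)"
    \<comment> \<open>Both sides are morphisms with the same first component, so no computation with
      the lift of the identity is required.\<close>
    proof (rule eqI[OF _ _ _ A A])
      show "?Fm A A (Idt Boole A) \<in> Hom kMaps (compact_map A) (compact_map A)"
        using A by (intro Hom) (simp_all add: Boole restrict_id_bool_hom)
      show "Idt kMaps (compact_map A) \<in> Hom kMaps (compact_map A) (compact_map A)"
        using A by (intro kMaps.Idt_in_Hom) (auto simp: Obj_kMaps)
    qed (simp add: Idt_kMaps Boole)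
  next
    fix A B C :: "'a gorder" and \<phi> \<psi>
    assume "A \<in> Obj Boole" "B \<in> Obj Boole" "C \<in> Obj Boole"
      and "\<phi> \<in> Hom Boole A B" "\<psi> \<in> Hom Boole B C"
    then have A: "boolean_alg A" and B: "boolean_alg B" and C: "boolean_alg C"
      and \<phi>: "\<phi> \<in> bool_hom A B" and \<psi>: "\<psi> \<in> bool_hom B C"
      by (simp_all add: Boole)
    show "?Fm A C (Cmp Boole A B C \<psi> \<phi>) =
      Cmp kMaps (compact_map A) (compact_map B) (compact_map C) (?Fm B C \<psi>) (?Fm A B \<phi>)"
    proof (rule eqI[OF _ _ _ A C])
      show "?Fm A C (Cmp Boole A B C \<psi> \<phi>) \<in> Hom kMaps (compact_map A) (compact_map C)"
        using A C \<phi> \<psi> by (intro Hom) (simp_all add: Boole compose_bool_hom)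
      show "Cmp kMaps (compact_map A) (compact_map B) (compact_map C) (?Fm B C \<psi>) (?Fm A B \<phi>)
          \<in> Hom kMaps (compact_map A) (compact_map C)"
        using A B C \<phi> \<psi> by (intro kMaps.Cmp_in_Hom Hom) (auto simp: Obj_kMaps)
    qed (simp add: Cmp_kMaps Boole)
  qed (use Hom in \<open>auto simp: Boole Obj_kMaps\<close>)
  \<comment> \<open>The inverse functor keeps the domain and the first component, and
    \<open>mzMaps\<close> has componentwise identities and composites.\<close>
  moreover have "cat_functor kMaps (Boole :: ('a gorder, 'a \<Rightarrow> 'a) cat) Dom (\<lambda>_ _. fst)"
    by (intro cat_functor.intro cat_functor_axioms.intro category_kMaps category_Boole)
      (auto simp: Obj_kMaps Boole Hom_kMaps Idt_kMaps Cmp_kMaps)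
  \<comment> \<open>The composites are identities on objects by \<open>Dom_compact_map\<close>; on
    morphisms of \<open>kMaps\<close>, \<open>Hom_kMaps\<close> restores the second component from
    the first.\<close>
  ultimately show ?thesis
    unfolding isomorphic_cats_def
    by (intro exI[of _ compact_map] exI[of _ ?Fm] exI[of _ Dom] exI[of _ "\<lambda>_ _. fst"])
      (auto simp: Obj_kMaps Hom_kMaps)
qed

end
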